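(* Let $\Psi:\mathbb{R}^n\to\mathbb{R}\cup\{\infty\}$ be proper, closed and convex, $\delta\ge0$, $B\succ0$ and $x,g,u\in\mathbb{R}^n$. The following are equivalent: (i) $u\in\mathrm{Prox}^B_\Psi(x,g,\delta)$. (ii) There exist $\hat\delta\in[0,\delta]$ and $v\in\mathbb{R}^n$ such that $\|v\|_B^*\le\sqrt{2(\delta-\hat\delta)}$ and $v-g-B(u-x)\in\partial_{\hat\delta}\Psi(u)$. (iii) There exist $\hat\delta\in[0,\delta]$ and $v\in\mathbb{R}^n$ such that $\|v\|_B^*\le\sqrt{2(\delta-\hat\delta)}$ and $$\langle v-g-B(u-x),\,y-u\rangle\le\Psi(y)-\Psi(u)+\hat\delta\quad\text{for all }y\in\mathbb{R}^n.$$
   Context: $\langle\cdot,\cdot\rangle$ is an inner product on $\mathbb{R}^n$; for $B\in\mathbb{R}^{n\times n}$ positive definite (written $B\succ0$; self-adjoint), $\|\cdot\|_B$ is the norm induced by $(x,y)\mapsto\langle Bx,y\rangle$ and $\|\cdot\|_B^*=\|\cdot\|_{B^{-1}}$ is its dual norm. The inexact pre-conditioned proximal map is the set $$\mathrm{Prox}^B_\Psi(x,g,\delta)=\left\{y:\langle g,y\rangle+\tfrac12\|y-x\|_B^2+\Psi(y)\le\min_{z\in\mathbb{R}^n}\left\{\langle g,z\rangle+\tfrac12\|z-x\|_B^2+\Psi(z)\right\}+\delta\right\}.$$ For $\delta\ge0$ and $x\in\mathrm{dom}(\Psi)$, the $\delta$-subdifferential is $\partial_\delta\Psi(x)=\{s:\Psi(y)\ge\Psi(x)+\langle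 s,y-x\rangle-\delta\ \forall y\in\mathbb{R}^n\}$; it is defined only at points of $\mathrm{dom}(\Psi)$ (empty elsewhere), and the inequality in (iii) is likewise understood to include $u\in\mathrm{dom}(\Psi)$. *)

theory Defs
  imports "HOL-Analysis.Analysis"
begin

text \<open>The inner product on \<open>\<real>\<^sup>n\<close> is arbitrary, hence an explicit parameter \<open>ip\<close> rather than
  the one fixed by the type class instance of \<^typ>\<open>real ^ 'n\<close>.\<close>

definition inner_product :: "(real^'n \<Rightarrow> real^'n \<Rightarrow> real) \<Rightarrow> bool" where
  "inner_product ip \<longleftrightarrow>
     bilinear ip \<and> (\<forall>x y. ip x y = ip y x) \<and> (\<forall>x. x \<noteq> 0 \<longrightarrow> ip x x > 0)"

definition pos_def :: "(real^'n \<Rightarrow> real^'n \<Rightarrow> real) \<Rightarrow> real^'n^'n \<Rightarrow> bool" where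
  "pos_def ip B \<longleftrightarrow>
     (\<forall>x y. ip (B *v x) y = ip x (B *v y)) \<and> (\<forall>x. x \<noteq> 0 \<longrightarrow> ip (B *v x) x > 0)"

definition mat_norm :: "(real^'n \<Rightarrow> real^'n \<Rightarrow> real) \<Rightarrow> real^'n^'n \<Rightarrow> real^'n \<Rightarrow> real" where
  "mat_norm ip B x = sqrt (ip (B *v x) x)"

definition dual_mat_norm :: "(real^'n \<Rightarrow> real^'n \<Rightarrow> real) \<Rightarrow> real^'n^'n \<Rightarrow> real^'n \<Rightarrow> real" where
  "dual_mat_norm ip B = mat_norm ip (matrix_inv B)"

definition effective_dom :: "('a \<Rightarrow> ereal) \<Rightarrow> 'a set" where
  "effective_dom \<Psi> = {x. \<Psi> x < \<infinity>}"

definition proper_fun :: "('a \<Rightarrow> ereal) \<Rightarrow> bool" where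
  "proper_fun \<Psi> \<longleftrightarrow> (\<forall>x. \<Psi> x \<noteq> -\<infinity>) \<and> effective_dom \<Psi> \<noteq> {}"

text \<open>Only real heights occur in the epigraph, as is usual for extended-valued functions.\<close>

definition ereal_epigraph :: "('a \<Rightarrow> ereal) \<Rightarrow> ('a \<times> real) set" where
  "ereal_epigraph \<Psi> = {(x, t). \<Psi> x \<le> ereal t}"

definition closed_fun :: "('a::topological_space \<Rightarrow> ereal) \<Rightarrow> bool" where
  "closed_fun \<Psi> \<longleftrightarrow> closed (ereal_epigraph \<Psi>)"

definition convex_fun :: "('a::real_vector \<Rightarrow> ereal) \<Rightarrow> bool" where
  "convex_fun \<Psi> \<longleftrightarrow> convex (ereal_epigraph \<Psi>)"

definition prox_objective ::
  "(real^'n \<Rightarrow> real^'n \<Rightarrow> real) \<Rightarrow> real^'n^'n \<Rightarrow> (real^'n \<Rightarrow> ereal) \<Rightarrow> real^'n \<Rightarrow> real^'n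
     \<Rightarrow> real^'n \<Rightarrow> ereal" where
  "prox_objective ip B \<Psi> x g y = ereal (ip g y + 1/2 * (mat_norm ip B (y - x))\<^sup>2) + \<Psi> y"

text \<open>The minimum is written as an infimum in \<^typ>\<open>ereal\<close>; for \<open>B\<close> positive definite and
  \<open>\<Psi>\<close> proper, closed and convex it is attained and finite.\<close>

definition inexact_prox ::
  "(real^'n \<Rightarrow> real^'n \<Rightarrow> real) \<Rightarrow> real^'n^'n \<Rightarrow> (real^'n \<Rightarrow> ereal) \<Rightarrow> real^'n \<Rightarrow> real^'n
     \<Rightarrow> real \<Rightarrow> (real^'n) set" where
  "inexact_prox ip B \<Psi> x g \<delta> =
     {y. prox_objective ip B \<Psi> x g y \<le> (INF z. prox_objective ip B \<Psi> x g z) + ereal \<delta>}"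

definition eps_subdifferential ::
  "(real^'n \<Rightarrow> real^'n \<Rightarrow> real) \<Rightarrow> (real^'n \<Rightarrow> ereal) \<Rightarrow> real \<Rightarrow> real^'n \<Rightarrow> (real^'n) set" where
  "eps_subdifferential ip \<Psi> \<delta> x =
     {s. x \<in> effective_dom \<Psi> \<and> (\<forall>y. \<Psi> y \<ge> \<Psi> x + ereal (ip s (y - x)) - ereal \<delta>)}"

end

theory Submission
  imports Defs
begin

text \<open>Membership in the inexact proximal set says that \<open>\<Psi>\<close> lies above the concave quadratic
  \<open>\<Psi> u - \<delta> - \<langle>g + B (u - x), z - u\<rangle> - \<parallel>z - u\<parallel>\<^sub>B\<^sup>2 / 2\<close>. Separating the epigraph of \<open>\<Psi>\<close> from
  the strict hypograph of this quadratic puts an affine function between them. Its gradient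
  is the approximate subgradient, its gap to \<open>\<Psi>\<close> at \<open>u\<close> is \<open>\<delta>'\<close>, and minimizing
  affine minus quadratic bounds the dual norm of \<open>v\<close>. Completing the square gives the converse.\<close>

section \<open>Separating a convex function from a concave minorant\<close>

lemma convex_strict_hypograph:
  assumes "convex_on UNIV h"
  shows "convex {(z, t). t < - h z}"
proof (rule convexI, clarsimp)
  fix z1 z2 :: 'a and t1 t2 a b :: real
  assume t: "t1 < - h z1" "t2 < - h z2" and ab: "0 \<le> a" "0 \<le> b" "a + b = 1"
  have "h (a *\<^sub>R z1 + b *\<^sub>R z2) \<le> a * h z1 + b * h z2"
    using assms ab by (auto simp: convex_on_def)
  moreover have "a * t1 + b * t2 < a * (- h z1) + b * (- h z2)"
  \<comment> \<open>Strictness survives only through a positive weight: if \<open>a = 0\<close> then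
    \<open>b = 1\<close>, and the second point supplies it.\<close>
  proof (cases "a = 0")
    case False
    then have "a * t1 < a * (- h z1)"
      using t ab by (intro mult_strict_left_mono) auto
    moreover have "b * t2 \<le> b * (- h z2)"
      using t ab by (intro mult_left_mono) auto
    ultimately show ?thesis by linarith
  qed (use t ab in auto)
  ultimately show "a * t1 + b * t2 < - h (a *\<^sub>R z1 + b *\<^sub>R z2)" by simp
qed

text \<open>The separating hyperplane cannot be vertical because \<open>h\<close> is finite
  everywhere, so the hypograph has points over every \<open>z\<close>. Solving its equation for the
  height gives the affine function.\<close>

lemma affine_between_concave_and_convex:
  fixes \<Psi> :: "'a::euclidean_space \<Rightarrow> ereal"
  assumes \<Psi>: "convex_fun \<Psi>" "effective_dom \<Psi> \<noteq> {}" and h: "convex_on UNIV h"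
    and le: "\<And>z. ereal (- h z) \<le> \<Psi> z"
  obtains p c where "\<And>z. - h z \<le> p \<bullet> z + c" "\<And>z. ereal (p \<bullet> z + c) \<le> \<Psi> z"
proof -
  let ?S = "{(z, t). t < - h z}"
  obtain z0 where "\<Psi> z0 < \<infinity>" using \<Psi>(2) by (auto simp: effective_dom_def)
  then obtain t0 where "\<Psi> z0 \<le> ereal t0"
    by (cases "\<Psi> z0") auto
  then have "(z0, t0) \<in> ereal_epigraph \<Psi>" by (simp add: ereal_epigraph_def)
  moreover have "(0, - h 0 - 1) \<in> ?S" by simp
  moreover have "?S \<inter> ereal_epigraph \<Psi> = {}"
  proof -
    have False if "t < - h z" "\<Psi> z \<le> ereal t" for z t
      using le[of z] that order_trans by fastforce
    then show ?thesis by (auto simp: ereal_epigraph_def)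
  qed
  moreover have "convex (ereal_epigraph \<Psi>)" using \<Psi>(1) by (simp add: convex_fun_def)
  ultimately obtain a b where a: "a \<noteq> 0" and S: "\<forall>y\<in>?S. a \<bullet> y \<le> b"
      and T: "\<forall>y\<in>ereal_epigraph \<Psi>. a \<bullet> y \<ge> b"
    using separating_hyperplane_sets[OF convex_strict_hypograph[OF h], of "ereal_epigraph \<Psi>"]
    by (metis empty_iff)
  obtain p q where pq: "a = (p, q)" by (cases a)
  have S': "p \<bullet> z + q * t \<le> b" if "t < - h z" for z t
    using S that by (auto simp: pq)
  have T': "b \<le> p \<bullet> z + q * t" if "\<Psi> z \<le> ereal t" for z t
    using T that by (auto simp: pq ereal_epigraph_def)
  have "q \<ge> 0"
  proof (rule ccontr)
    assume q: "\<not> q \<ge> 0"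
    \<comment> \<open>The hypograph is unbounded below: the first bound keeps \<open>(0, t)\<close>
      in it, the second forces \<open>q * t\<close> past \<open>b\<close> when \<open>q\<close> is
      negative.\<close>
    define t where "t = min (- h 0 - 1) ((b + 1) / q)"
    have "q * ((b + 1) / q) \<le> q * t"
      using q by (intro mult_left_mono_neg) (auto simp: t_def)
    then have "b + 1 \<le> q * t" using q by simp
    moreover have "t < - h 0" by (simp add: t_def)
    ultimately show False using S'[of t 0] by simp
  qed
  moreover have "q \<noteq> 0"
  proof
    assume q: "q = 0"
    then have "p \<noteq> 0" using a pq by (simp add: zero_prod_def)
    \<comment> \<open>A vertical hyperplane would bound the nonzero functional \<open>p\<close> by
      \<open>b\<close> on the whole space; this multiple of \<open>p\<close> exceeds the
      bound.\<close>
    then have "p \<bullet> (((b + 1) / (p \<bullet> p)) *\<^sub>R p) = b + 1" by simp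
    moreover have "p \<bullet> z \<le> b" for z
      using S'[of "- h z - 1" z] q by simp
    ultimately show False by (metis add_le_same_cancel1 not_one_le_zero)
  qed
  ultimately have q: "q > 0" by simp
  have aff: "(- p /\<^sub>R q) \<bullet> z + b / q = (b - p \<bullet> z) / q" for z
    by (simp add: diff_divide_distrib) (simp add: divide_inverse mult.commute)
  show thesis
  proof
    fix z
    have "t \<le> (b - p \<bullet> z) / q" if "t < - h z" for t
      using S'[OF that] q by (simp add: field_simps)
    then show "- h z \<le> (- p /\<^sub>R q) \<bullet> z + b / q"
      unfolding aff by (rule dense_le)
    show "ereal ((- p /\<^sub>R q) \<bullet> z + b / q) \<le> \<Psi> z"
      unfolding aff
    \<comment> \<open>Testing against all real heights above \<open>\<Psi> z\<close> also covers
      \<open>\<Psi> z = \<infinity>\<close>, where there are none.\<close>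
    proof (rule ereal_le_real)
      fix t
      assume "\<Psi> z \<le> ereal t"
      from T'[OF this] show "ereal ((b - p \<bullet> z) / q) \<le> ereal t"
        using q by (simp add: field_simps)
    qed
  qed
qed

section \<open>Arbitrary inner products and positive definite matrices\<close>

lemma inner_product_simps:
  assumes "inner_product ip"
  shows "ip (x + y) z = ip x z + ip y z" "ip z (x + y) = ip z x + ip z y"
    "ip (x - y) z = ip x z - ip y z" "ip z (x - y) = ip z x - ip z y"
    "ip (c *\<^sub>R x) z = c * ip x z" "ip z (c *\<^sub>R x) = c * ip z x"
    "ip (- x) z = - ip x z" "ip z (- x) = - ip z x"
proof -
  have b: "bilinear ip" using assms by (simp add: inner_product_def)
  show "ip (x + y) z = ip x z + ip y z" "ip z (x + y) = ip z x + ip z y"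
    "ip (x - y) z = ip x z - ip y z" "ip z (x - y) = ip z x - ip z y"
    "ip (c *\<^sub>R x) z = c * ip x z" "ip z (c *\<^sub>R x) = c * ip z x"
    "ip (- x) z = - ip x z" "ip z (- x) = - ip z x"
    using bilinear_ladd[OF b] bilinear_radd[OF b] bilinear_lsub[OF b] bilinear_rsub[OF b]
      bilinear_lmul[OF b] bilinear_rmul[OF b] bilinear_lneg[OF b] bilinear_rneg[OF b]
    by auto
qed

lemma inner_product_commute: "inner_product ip \<Longrightarrow> ip x y = ip y x"
  by (simp add: inner_product_def)

text \<open>Turns a gradient for the standard dot product into one for \<open>ip\<close>. The map
  \<open>L\<close> from \<open>x\<close> to the dot-product representative of \<open>ip x\<close> is
  injective by definiteness, hence surjective in finite dimension.\<close>

lemma inner_product_riesz: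
  assumes ip: "inner_product ip"
  obtains v where "\<And>d. ip v d = p \<bullet> d"
proof -
  define L where "L x = (\<Sum>b\<in>Basis. ip x b *\<^sub>R b)" for x
  have lin: "linear (ip x)" for x
    using ip by (simp add: inner_product_def bilinear_def)
  have L: "L x \<bullet> d = ip x d" for x d
  proof -
    have "ip x d = ip x (\<Sum>b\<in>Basis. (d \<bullet> b) *\<^sub>R b)" by (simp add: euclidean_representation)
    also have "\<dots> = (\<Sum>b\<in>Basis. (d \<bullet> b) * ip x b)"
      by (simp add: linear_sum[OF lin] linear_scale[OF lin])
    finally show ?thesis
      unfolding L_def inner_sum_left by (simp add: inner_commute mult.commute)
  qed
  have linL: "linear L"
    by (rule linearI)
      (simp_all add: L_def inner_product_simps[OF ip] algebra_simps sum.distrib scaleR_sum_right)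
  have "x = 0" if "L x = 0" for x
  proof (rule ccontr)
    assume "x \<noteq> 0"
    then have "ip x x > 0" using ip by (simp add: inner_product_def)
    then show False using L[of x x] that by simp
  qed
  then have "surj L"
    using linear_injective_imp_surjective[OF linL] linear_injective_0[OF linL] by blast
  then obtain v where "L v = p" by (metis surj_def)
  with that L show thesis by metis
qed

lemma pos_def_nonneg:
  assumes "inner_product ip" "pos_def ip B"
  shows "0 \<le> ip (B *v d) d"
proof (cases "d = 0")
  case True
  then show ?thesis using inner_product_simps(5)[OF assms(1), of 0] by simp
next
  case False
  then have "0 < ip (B *v d) d" using assms(2) unfolding pos_def_def by blast
  then show ?thesis by simp
qed

lemma pos_def_mult_matrix_inv:
  assumes "inner_product ip" "pos_def ip B"
  shows "B *v (matrix_inv B *v v) = v"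
proof -
  have "d = 0" if "B *v d = 0" for d
  proof (rule ccontr)
    assume "d \<noteq> 0"
    then have "ip (B *v d) d > 0" using assms(2) unfolding pos_def_def by blast
    then show False using that inner_product_simps(5)[OF assms(1), of 0] by simp
  qed
  then have "invertible B"
    using invertible_left_inverse matrix_left_invertible_ker by blast
  then have "B ** matrix_inv B = mat 1"
    unfolding matrix_inv_def invertible_def by (rule someI2_ex) simp
  then show ?thesis by (simp add: matrix_vector_mul_assoc)
qed

lemma pos_def_quadratic_add:
  assumes ip: "inner_product ip" and B: "pos_def ip B"
  shows "ip (B *v (a + b)) (a + b) = ip (B *v a) a + 2 * ip (B *v a) b + ip (B *v b) b"
proof -
  have "ip (B *v b) a = ip (B *v a) b"
    using B inner_product_commute[OF ip] by (metis pos_def_def)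
  then show ?thesis
    by (simp add: matrix_vector_right_distrib inner_product_simps[OF ip])
qed

lemma mat_norm_squared:
  assumes "inner_product ip" "pos_def ip B"
  shows "(mat_norm ip B d)\<^sup>2 = ip (B *v d) d"
  using pos_def_nonneg[OF assms] by (simp add: mat_norm_def)

text \<open>With \<open>w\<close> the preimage of \<open>v\<close> under \<open>B\<close>,
  completing the square shows that the right-hand expression is least at \<open>d = - w\<close>,
  with value \<open>- ip v w / 2\<close>, and \<open>ip v w\<close> is the squared dual
  norm.\<close>

lemma dual_mat_norm_le_iff:
  assumes ip: "inner_product ip" and B: "pos_def ip B"
  shows "dual_mat_norm ip B v \<le> sqrt (2 * c) \<longleftrightarrow> (\<forall>d. - c \<le> ip v d + ip (B *v d) d / 2)"
proof -
  define w where "w = matrix_inv B *v v"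
  have Bw: "B *v w = v" by (simp add: w_def pos_def_mult_matrix_inv[OF assms])
  \<comment> \<open>\<open>sqrt\<close> is odd and strictly increasing on all reals, so no sign
    condition on \<open>c\<close> arises.\<close>
  have "dual_mat_norm ip B v \<le> sqrt (2 * c) \<longleftrightarrow> ip v w \<le> 2 * c"
    by (simp add: dual_mat_norm_def mat_norm_def flip: w_def) (metis ip inner_product_commute)
  also have "\<dots> \<longleftrightarrow> (\<forall>d. - c \<le> ip v d + ip (B *v d) d / 2)"
  proof
    assume le: "ip v w \<le> 2 * c"
    show "\<forall>d. - c \<le> ip v d + ip (B *v d) d / 2"
    proof
      fix d
      show "- c \<le> ip v d + ip (B *v d) d / 2"
        using pos_def_nonneg[OF assms, of "w + d"] le
        unfolding pos_def_quadratic_add[OF assms] Bw by argo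
    qed
  next
    assume "\<forall>d. - c \<le> ip v d + ip (B *v d) d / 2"
    then have "- c \<le> ip v (- w) + ip (B *v (- w)) (- w) / 2" by blast
    moreover have "B *v (- w) = - v"
      using Bw matrix_vector_mult_diff_distrib[of B 0 w] by simp
    ultimately show "ip v w \<le> 2 * c" by (simp add: inner_product_simps[OF ip])
  qed
  finally show ?thesis .
qed

lemma convex_on_pos_def_quadratic:
  assumes ip: "inner_product ip" and B: "pos_def ip B"
  shows "convex_on UNIV (\<lambda>z. c + ip w (z - u) + ip (B *v (z - u)) (z - u) / 2)"
proof (rule convex_onI)
  fix t :: real and y z
  assume t: "0 < t" "t < 1"
  define r where "r = y - u"
  define d where "d = z - y"
  let ?q = "\<lambda>z. ip (B *v z) z"
  have *: "(1 - t) *\<^sub>R y + t *\<^sub>R z - u = r + t *\<^sub>R d" "y - u = r" "z - u = r + d"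
    by (simp_all add: r_def d_def algebra_simps)
  \<comment> \<open>The affine terms cancel, and the convexity gap is
    \<open>t * (1 - t) * ?q d / 2\<close>.\<close>
  have "t * t * ?q d \<le> t * ?q d"
    using t pos_def_nonneg[OF assms, of d] by (simp add: mult_left_le_one_le mult_right_mono)
  then show "c + ip w ((1 - t) *\<^sub>R y + t *\<^sub>R z - u)
      + ?q ((1 - t) *\<^sub>R y + t *\<^sub>R z - u) / 2
    \<le> (1 - t) * (c + ip w (y - u) + ?q (y - u) / 2) + t * (c + ip w (z - u) + ?q (z - u) / 2)"
    unfolding *
    unfolding pos_def_quadratic_add[OF assms]
    unfolding matrix_vector_mult_scaleR inner_product_simps[OF ip]
    by (simp add: field_simps)
qed simp

section \<open>Proximal points and approximate subgradients as lower bounds on \<Psi>\<close>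

text \<open>Expanding the quadratic about \<open>u\<close> cancels its value there and leaves the
  linear term \<open>B *v (u - x)\<close>. Properness supplies a competitor of finite value, which
  rules out \<open>\<Psi> u = \<infinity>\<close>.\<close>

lemma inexact_prox_iff:
  assumes ip: "inner_product ip" and B: "pos_def ip B" and \<Psi>: "proper_fun \<Psi>"
  shows "u \<in> inexact_prox ip B \<Psi> x g \<delta> \<longleftrightarrow>
    (\<exists>r. \<Psi> u = ereal r \<and>
      (\<forall>z. ereal (r - \<delta> - ip (g + B *v (u - x)) (z - u) - ip (B *v (z - u)) (z - u) / 2) \<le> \<Psi> z))"
    (is "?l \<longleftrightarrow> ?r")
proof -
  have ninf: "\<Psi> z \<noteq> - \<infinity>" for z using \<Psi> by (simp add: proper_fun_def)
  have eq: "?l \<longleftrightarrow>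
      (\<forall>z. prox_objective ip B \<Psi> x g u - ereal \<delta> \<le> prox_objective ip B \<Psi> x g z)"
    unfolding inexact_prox_def by (simp add: le_INF_iff flip: ereal_minus_le)
  show ?thesis
  proof (cases "\<Psi> u")
    case (real r)
    have "prox_objective ip B \<Psi> x g u - ereal \<delta> \<le> prox_objective ip B \<Psi> x g z \<longleftrightarrow>
      ereal (r - \<delta> - ip (g + B *v (u - x)) (z - u) - ip (B *v (z - u)) (z - u) / 2) \<le> \<Psi> z" for z
    proof -
      have "z - x = (u - x) + (z - u)" by simp
      then have "ip (B *v (z - x)) (z - x) = ip (B *v (u - x)) (u - x)
          + 2 * ip (B *v (u - x)) (z - u) + ip (B *v (z - u)) (z - u)"
        using pos_def_quadratic_add[OF ip B, of "u - x" "z - u"] by simp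
      then show ?thesis
        using real ninf[of z]
        by (cases "\<Psi> z") (auto simp: prox_objective_def mat_norm_squared[OF ip B]
            inner_product_simps(1)[OF ip] inner_product_simps(4)[OF ip, of g z] field_simps)
    qed
    then show ?thesis using eq real by simp
  next
    case PInf
    obtain z where "\<Psi> z < \<infinity>" using \<Psi> by (auto simp: proper_fun_def effective_dom_def)
    then have "\<not> prox_objective ip B \<Psi> x g u - ereal \<delta> \<le> prox_objective ip B \<Psi> x g z"
      using PInf ninf[of z] by (cases "\<Psi> z") (auto simp: prox_objective_def)
    then show ?thesis using eq PInf by auto
  qed (use ninf in simp)
qed

lemma mem_eps_subdifferential_iff:
  assumes "proper_fun \<Psi>"
  shows "s \<in> eps_subdifferential ip \<Psi> \<epsilon> u \<longleftrightarrow>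
    (\<exists>r. \<Psi> u = ereal r \<and> (\<forall>y. ereal (r + ip s (y - u) - \<epsilon>) \<le> \<Psi> y))"
proof (cases "\<Psi> u")
  case (real r)
  then show ?thesis by (simp add: eps_subdifferential_def effective_dom_def)
qed (use assms in \<open>auto simp: eps_subdifferential_def effective_dom_def proper_fun_def\<close>)

text \<open>Links (ii) and (iii): on the domain \<open>\<Psi> u\<close> is a real number and can be
  moved across the inequality.\<close>

lemma mem_eps_subdifferential_iff_diff:
  assumes "proper_fun \<Psi>"
  shows "s \<in> eps_subdifferential ip \<Psi> \<epsilon> u \<longleftrightarrow>
    u \<in> effective_dom \<Psi> \<and> (\<forall>y. ereal (ip s (y - u)) \<le> \<Psi> y - \<Psi> u + ereal \<epsilon>)"
proof (cases "\<Psi> u")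
  case (real r)
  have "ereal (r + ip s (y - u) - \<epsilon>) \<le> \<Psi> y \<longleftrightarrow>
      ereal (ip s (y - u)) \<le> \<Psi> y - \<Psi> u + ereal \<epsilon>" for y
    using real by (cases "\<Psi> y") auto
  then show ?thesis
    using real by (simp add: mem_eps_subdifferential_iff[OF assms] effective_dom_def)
qed (use assms in \<open>auto simp: eps_subdifferential_def effective_dom_def proper_fun_def\<close>)

section \<open>Equivalence of the three conditions\<close>

lemma inexact_prox_iff_eps_subdifferential:
  assumes ip: "inner_product ip" and B: "pos_def ip B"
    and \<Psi>: "proper_fun \<Psi>" "convex_fun \<Psi>"
  shows "u \<in> inexact_prox ip B \<Psi> x g \<delta> \<longleftrightarrow>
    (\<exists>\<delta>'\<in>{0..\<delta>}. \<exists>v. dual_mat_norm ip B v \<le> sqrt (2 * (\<delta> - \<delta>')) \<and>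
      v - g - B *v (u - x) \<in> eps_subdifferential ip \<Psi> \<delta>' u)"
    (is "?l \<longleftrightarrow> ?r")
proof -
  define w where "w = g + B *v (u - x)"
  have diff_w: "v - g - B *v (u - x) = v - w" for v by (simp add: w_def)
  let ?q = "\<lambda>d. ip (B *v d) d"
  show ?thesis
    unfolding inexact_prox_iff[OF ip B \<Psi>(1)] mem_eps_subdifferential_iff[OF \<Psi>(1)]
      dual_mat_norm_le_iff[OF ip B] diff_w w_def[symmetric]
  proof
    assume "\<exists>r. \<Psi> u = ereal r \<and> (\<forall>z. ereal (r - \<delta> - ip w (z - u) - ?q (z - u) / 2) \<le> \<Psi> z)"
    then obtain r where r: "\<Psi> u = ereal r"
      and le: "\<And>z. ereal (r - \<delta> - ip w (z - u) - ?q (z - u) / 2) \<le> \<Psi> z" by blast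
    define h where "h z = (\<delta> - r) + ip w (z - u) + ?q (z - u) / 2" for z
    have "convex_on UNIV h"
      unfolding h_def by (rule convex_on_pos_def_quadratic[OF ip B])
    moreover have "ereal (- h z) \<le> \<Psi> z" for z
      using le[of z] by (simp add: h_def algebra_simps)
    moreover have "effective_dom \<Psi> \<noteq> {}" using \<Psi>(1) by (simp add: proper_fun_def)
    ultimately obtain p c where p: "\<And>z. - h z \<le> p \<bullet> z + c" "\<And>z. ereal (p \<bullet> z + c) \<le> \<Psi> z"
      using affine_between_concave_and_convex[OF \<Psi>(2)] by blast
    obtain s where s: "\<And>d. ip s d = p \<bullet> d" using inner_product_riesz[OF ip] by blast
    define \<delta>' where "\<delta>' = r - (p \<bullet> u + c)"
    \<comment> \<open>The witness is \<open>v = s + w\<close>, so that \<open>v - w\<close> is the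
      gradient \<open>s\<close>. The bound says that the affine function dominates
      \<open>- h\<close> at \<open>u + d\<close>; at \<open>d = 0\<close> it yields
      \<open>\<delta>' \<le> \<delta>\<close>.\<close>
    have low: "- (\<delta> - \<delta>') \<le> ip (s + w) d + ?q d / 2" for d
      using p(1)[of "u + d"]
      by (simp add: h_def \<delta>'_def inner_product_simps(1)[OF ip] s inner_add_right)
    have "ip a 0 = 0" for a using inner_product_simps(6)[OF ip, of a 0] by simp
    then have "\<delta>' \<le> \<delta>" using low[of 0] by simp
    moreover have "0 \<le> \<delta>'" using p(2)[of u] r by (simp add: \<delta>'_def)
    moreover have "ereal (r + ip (s + w - w) (y - u) - \<delta>') \<le> \<Psi> y" for y
      using p(2)[of y] by (simp add: \<delta>'_def s inner_diff_right add.commute)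
    ultimately show "\<exists>\<delta>'\<in>{0..\<delta>}. \<exists>v. (\<forall>d. - (\<delta> - \<delta>') \<le> ip v d + ?q d / 2) \<and>
        (\<exists>r. \<Psi> u = ereal r \<and> (\<forall>y. ereal (r + ip (v - w) (y - u) - \<delta>') \<le> \<Psi> y))"
      using low r by (metis atLeastAtMost_iff)
  next
    assume "\<exists>\<delta>'\<in>{0..\<delta>}. \<exists>v. (\<forall>d. - (\<delta> - \<delta>') \<le> ip v d + ?q d / 2) \<and>
        (\<exists>r. \<Psi> u = ereal r \<and> (\<forall>y. ereal (r + ip (v - w) (y - u) - \<delta>') \<le> \<Psi> y))"
    then obtain \<delta>' v r where low: "\<And>d. - (\<delta> - \<delta>') \<le> ip v d + ?q d / 2" and r: "\<Psi> u = ereal r"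
      and le: "\<And>y. ereal (r + ip (v - w) (y - u) - \<delta>') \<le> \<Psi> y" by blast
    \<comment> \<open>The dual norm bound at \<open>d = z - u\<close> places the quadratic below the
      affine minorant of \<Psi>.\<close>
    have "ereal (r - \<delta> - ip w (z - u) - ?q (z - u) / 2) \<le> \<Psi> z" for z
    proof (rule order_trans[OF _ le])
      show "ereal (r - \<delta> - ip w (z - u) - ?q (z - u) / 2)
          \<le> ereal (r + ip (v - w) (z - u) - \<delta>')"
        using low[of "z - u"] by (simp add: inner_product_simps(3)[OF ip])
    qed
    with r show "\<exists>r. \<Psi> u = ereal r \<and>
        (\<forall>z. ereal (r - \<delta> - ip w (z - u) - ?q (z - u) / 2) \<le> \<Psi> z)" by blast
  qed
qed

theorem theorem3p3p2:
  fixes ip :: "real^'n \<Rightarrow> real^'n \<Rightarrow> real"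
    and \<Psi> :: "real^'n \<Rightarrow> ereal"
    and \<delta> :: real
    and B :: "real^'n^'n"
    and x g u :: "real^'n"
  assumes "inner_product ip"
    and "proper_fun \<Psi>" and "closed_fun \<Psi>" and "convex_fun \<Psi>"
    and "\<delta> \<ge> 0"
    and "pos_def ip B"
  shows "(u \<in> inexact_prox ip B \<Psi> x g \<delta> \<longleftrightarrow>
            (\<exists>\<delta>'\<in>{0..\<delta>}. \<exists>v. dual_mat_norm ip B v \<le> sqrt (2 * (\<delta> - \<delta>')) \<and>
               v - g - B *v (u - x) \<in> eps_subdifferential ip \<Psi> \<delta>' u)) \<and>
         (u \<in> inexact_prox ip B \<Psi> x g \<delta> \<longleftrightarrow>
            (\<exists>\<delta>'\<in>{0..\<delta>}. \<exists>v. dual_mat_norm ip B v \<le> sqrt (2 * (\<delta> - \<delta>')) \<and>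
               u \<in> effective_dom \<Psi> \<and>
               (\<forall>y. ereal (ip (v - g - B *v (u - x)) (y - u)) \<le> \<Psi> y - \<Psi> u + ereal \<delta>')))"
  \<comment> \<open>Folding (iii) back into subdifferential membership makes both conjuncts the same
    equivalence.\<close>
  unfolding mem_eps_subdifferential_iff_diff[OF assms(2), symmetric]
  using inexact_prox_iff_eps_subdifferential[OF assms(1,6,2,4)] by blast

end
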